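(* Let $F=\mathbb{F}_q$ be the finite field with $q$ elements. Let $X$ be a conjugacy class in $M_2(F)$ whose characteristic polynomial is irreducible of degree $2$ over $F$, and let $Y$ be a conjugacy class in $M_2(F)$ whose characteristic polynomial is of the form $(T-\lambda)(T-\mu)$, where $\lambda,\mu\in F$ and $\lambda\neq\mu$. Let $z\in M_2(F)$ with $\mathrm{Tr}(z)=\mathrm{Tr}(X)+\mathrm{Tr}(Y)$. Then $N_{X,Y}(z)=0$ if $z$ is a scalar matrix, and otherwise $N_{X,Y}(z)\in\{q-1,q,q+1\}$.
   Context: $q$ is an arbitrary prime power. A conjugacy class in $M_n(F)$ is an orbit of $M_n(F)$ under conjugation by $\mathrm{GL}_n(F)$; its characteristic polynomial and trace $\mathrm{Tr}(X)$ are those of any of its elements. For conjugacy classes $X,Y\subset M_n(F)$ and $z\in M_n(F)$, $N_{X,Y}(z):=\#\{(x,y)\in X\times Y : x+y=z\}$. *)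

theory Defs
  imports "Jordan_Normal_Form.Char_Poly"
begin

text \<open>
  Matrices are those of \<^theory>\<open>Jordan_Normal_Form.Matrix\<close>: the set of all \<open>n \<times> n\<close> matrices
  over \<open>'a\<close> is \<open>carrier_mat n n\<close>.
\<close>

definition mat_trace :: "'a :: comm_monoid_add mat \<Rightarrow> 'a" where
  "mat_trace A = (\<Sum>i<dim_row A. A $$ (i, i))"

text \<open>
  \<open>similar_mat B A\<close> says that \<open>B = P * A * Q\<close> for some square matrices \<open>P\<close>, \<open>Q\<close> of the same size
  that are inverse to each other, so \<open>{B. similar_mat B A}\<close> is the orbit of \<open>A\<close> under conjugation
  by the general linear group.
\<close>

definition conj_class :: "nat \<Rightarrow> 'a :: field mat set \<Rightarrow> bool" where
  "conj_class n X \<longleftrightarrow> (\<exists>A \<in> carrier_mat n n. X = {B. similar_mat B A})"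

text \<open>
  The choice of an element in the next two definitions is immaterial, see \<open>class_char_poly_eq\<close> and
  \<open>class_trace_eq\<close> below.
\<close>

definition class_char_poly :: "'a :: field mat set \<Rightarrow> 'a poly" where
  "class_char_poly X = char_poly (SOME A. A \<in> X)"

definition class_trace :: "'a :: field mat set \<Rightarrow> 'a" where
  "class_trace X = mat_trace (SOME A. A \<in> X)"

definition sum_count :: "'a :: field mat set \<Rightarrow> 'a mat set \<Rightarrow> 'a mat \<Rightarrow> nat" where
  "sum_count X Y z = card {(x, y). x \<in> X \<and> y \<in> Y \<and> x + y = z}"

definition scalar_mat :: "'a :: field mat \<Rightarrow> bool" where
  "scalar_mat A \<longleftrightarrow> (\<exists>c. A = c \<cdot>\<^sub>m 1\<^sub>m (dim_row A))"

lemma conj_class_subset_carrier: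
  assumes "conj_class n X"
  shows "X \<subseteq> carrier_mat n n"
proof
  fix B assume "B \<in> X"
  with assms obtain A where A: "A \<in> carrier_mat n n" "similar_mat B A"
    by (auto simp: conj_class_def)
  then obtain m where "{B, A} \<subseteq> carrier_mat m m"
    using similar_matD[OF A(2)] by blast
  with A(1) show "B \<in> carrier_mat n n" by auto
qed

lemma conj_class_similar:
  assumes "conj_class n X" "A \<in> X" "B \<in> X"
  shows "similar_mat A B"
  using assms similar_mat_sym similar_mat_trans by (auto simp: conj_class_def) blast

lemma some_in_conj_class:
  assumes "conj_class n X"
  shows "(SOME A. A \<in> X) \<in> X"
proof -
  from assms have "\<exists>A. A \<in> X" by (auto simp: conj_class_def intro: similar_mat_refl)
  then show ?thesis by (rule someI_ex)
qed

lemma class_char_poly_eq: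
  assumes "conj_class n X" "A \<in> X"
  shows "class_char_poly X = char_poly A"
  unfolding class_char_poly_def
  by (rule char_poly_similar, rule conj_class_similar[OF assms(1) some_in_conj_class[OF assms(1)] assms(2)])

lemma mat_trace_mult_comm:
  fixes A B :: "'a :: comm_semiring_0 mat"
  assumes "A \<in> carrier_mat n m" "B \<in> carrier_mat m n"
  shows "mat_trace (A * B) = mat_trace (B * A)"
proof -
  have "mat_trace (A * B) = (\<Sum>i<n. \<Sum>j<m. A $$ (i, j) * B $$ (j, i))"
    using assms by (auto simp: mat_trace_def scalar_prod_def atLeast0LessThan intro!: sum.cong)
  also have "\<dots> = (\<Sum>j<m. \<Sum>i<n. B $$ (j, i) * A $$ (i, j))"
    by (subst sum.swap) (simp add: mult.commute)
  also have "\<dots> = mat_trace (B * A)"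
    using assms by (auto simp: mat_trace_def scalar_prod_def atLeast0LessThan intro!: sum.cong)
  finally show ?thesis .
qed

lemma mat_trace_similar:
  fixes A B :: "'a :: comm_ring_1 mat"
  assumes "similar_mat A B"
  shows "mat_trace A = mat_trace B"
proof -
  from similar_matD[OF assms] obtain n P Q where
    c: "{A, B, P, Q} \<subseteq> carrier_mat n n" and QP: "Q * P = 1\<^sub>m n" and A: "A = P * B * Q" by blast
  have "mat_trace A = mat_trace (Q * (P * B))"
    unfolding A using c by (intro mat_trace_mult_comm) auto
  also have "Q * (P * B) = (Q * P) * B"
    using c by (intro assoc_mult_mat[symmetric]) auto
  also have "\<dots> = B" unfolding QP using c by (intro left_mult_one_mat[of _ n n]) auto
  finally show ?thesis .
qed

lemma class_trace_eq:
  assumes "conj_class n X" "A \<in> X"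
  shows "class_trace X = mat_trace A"
  unfolding class_trace_def
  by (rule mat_trace_similar, rule conj_class_similar[OF assms(1) some_in_conj_class[OF assms(1)] assms(2)])

end

theory Submission
  imports Defs "HOL-Library.Cardinality"
begin

text \<open>
  An element \<open>y\<close> of \<open>Y\<close> has exactly one eigenline for the eigenvalue \<open>lam\<close>. Let a line be spanned by
  \<open>v\<close>. A pair \<open>x + y = z\<close> with \<open>y v = lam v\<close> satisfies \<open>x v = w\<close> for \<open>w = (z - lam) v\<close>. Since \<open>x\<close> has no
  eigenvectors, \<open>v, w\<close> is a basis, and \<open>x w = t w - d v\<close> by Cayley--Hamilton, where \<open>t\<close> and \<open>d\<close> are the
  trace and determinant of \<open>X\<close>; so \<open>x\<close> is determined by the line. Conversely these equations define a
  pair in \<open>X \<times> Y\<close> whenever \<open>v\<close> is not an eigenvector of \<open>z\<close>. Hence the count is \<open>q + 1\<close> minus the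
  number of eigenlines of \<open>z\<close>, which is \<open>q + 1\<close> for scalar \<open>z\<close> and at most \<open>2\<close> otherwise.
\<close>

section \<open>Two by two matrices and their conjugacy classes\<close>

definition mat2 :: "'a \<Rightarrow> 'a \<Rightarrow> 'a \<Rightarrow> 'a \<Rightarrow> 'a mat" where
  "mat2 a b c d = mat 2 2 (\<lambda>(i, j). if i = 0 then (if j = 0 then a else b) else (if j = 0 then c else d))"

lemma mat2_carrier [simp]: "mat2 a b c d \<in> carrier_mat 2 2"
  by (simp add: mat2_def)

lemma mat2_index [simp]:
  "mat2 a b c d $$ (0, 0) = a" "mat2 a b c d $$ (0, Suc 0) = b"
  "mat2 a b c d $$ (Suc 0, 0) = c" "mat2 a b c d $$ (Suc 0, Suc 0) = d"
  "dim_row (mat2 a b c d) = 2" "dim_col (mat2 a b c d) = 2"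
  by (simp_all add: mat2_def)

lemma mat_2_eqI:
  assumes "A \<in> carrier_mat 2 2" "B \<in> carrier_mat 2 2"
    and "A $$ (0, 0) = B $$ (0, 0)" "A $$ (0, Suc 0) = B $$ (0, Suc 0)"
    and "A $$ (Suc 0, 0) = B $$ (Suc 0, 0)" "A $$ (Suc 0, Suc 0) = B $$ (Suc 0, Suc 0)"
  shows "A = B"
proof (rule eq_matI)
  fix i j assume "i < dim_row B" "j < dim_col B"
  then show "A $$ (i, j) = B $$ (i, j)"
    using assms by (auto simp: less_2_cases_iff)
qed (use assms in auto)

lemma mat2_cases:
  assumes "A \<in> carrier_mat 2 2"
  obtains a b c d where "A = mat2 a b c d"
proof -
  have "A = mat2 (A $$ (0, 0)) (A $$ (0, Suc 0)) (A $$ (Suc 0, 0)) (A $$ (Suc 0, Suc 0))"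
    using assms by (intro mat_2_eqI) auto
  then show ?thesis by (rule that)
qed

lemma mat2_eq_iff: "mat2 a b c d = mat2 a' b' c' d' \<longleftrightarrow> a = a' \<and> b = b' \<and> c = c' \<and> d = d'"
  by (metis mat2_index(1-4))

lemma mat2_add: "mat2 a b c d + mat2 a' b' c' d' = mat2 (a + a') (b + b') (c + c') (d + d')"
  by (rule mat_2_eqI) auto

lemma mat2_mult:
  fixes a b c d :: "'a :: semiring_0"
  shows "mat2 a b c d * mat2 a' b' c' d' =
    mat2 (a * a' + b * c') (a * b' + b * d') (c * a' + d * c') (c * b' + d * d')"
  by (rule mat_2_eqI) (auto simp: scalar_prod_def numeral_2_eq_2)

lemma one_mat_2: "1\<^sub>m 2 = mat2 1 0 0 1"
  by (rule mat_2_eqI) auto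

lemma mat_trace_mat2: "mat_trace (mat2 a b c d) = a + d"
  by (simp add: mat_trace_def numeral_2_eq_2)

lemma scalar_mat_mat2: "scalar_mat (mat2 a b c d) \<longleftrightarrow> b = 0 \<and> c = 0 \<and> a = d"
proof -
  have "k \<cdot>\<^sub>m 1\<^sub>m 2 = mat2 k 0 0 k" for k :: 'a
    by (rule mat_2_eqI) auto
  then show ?thesis by (auto simp: scalar_mat_def mat2_eq_iff)
qed

lemma det_mat2: "det (mat2 a b c d) = a * d - b * (c :: 'a :: comm_ring_1)"
  by (subst laplace_expansion_row[of _ 2 0])
    (simp_all add: numeral_2_eq_2 cofactor_def det_single mat_delete_def mat2_def)

lemma char_poly_mat2:
  "char_poly (mat2 a b c d) = [:a * d - b * c, - (a + d), 1 :: 'a :: comm_ring_1:]"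
proof -
  have "char_poly_matrix (mat2 a b c d) = mat2 [:- a, 1:] [:- b:] [:- c:] [:- d, 1:]"
    unfolding char_poly_matrix_def by (rule mat_2_eqI) auto
  then show ?thesis
    unfolding char_poly_def by (simp add: det_mat2 algebra_simps)
qed

text \<open>A nonscalar matrix \<open>A\<close> has a vector \<open>v\<close> that is not an
  eigenvector. In the basis \<open>v\<close>, \<open>A v\<close> it acts by its companion matrix, by
  Cayley--Hamilton.\<close>

lemma nonscalar_similar_companion:
  fixes a b c d :: "'a :: field"
  assumes "\<not> (b = 0 \<and> c = 0 \<and> a = d)"
  shows "similar_mat (mat2 a b c d) (mat2 0 (b * c - a * d) 1 (a + d))"
proof -
  \<comment> \<open>If both coordinate vectors are eigenvectors, the matrix is diagonal with
    distinct entries, and (1, 1) is not an eigenvector.\<close>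
  obtain v1 v2 where "v1 * (c * v1 + d * v2) - v2 * (a * v1 + b * v2) \<noteq> 0"
  proof (cases "c = 0")
    case False
    then show ?thesis by (intro that[of 1 0]) simp
  next
    case c: True
    show ?thesis
    proof (cases "b = 0")
      case False
      then show ?thesis by (intro that[of 0 1]) simp
    next
      case True
      then show ?thesis using c assms by (intro that[of 1 1]) simp
    qed
  qed
  moreover define w1 w2 where "w1 = a * v1 + b * v2" and "w2 = c * v1 + d * v2"
  moreover define D i where "D = v1 * w2 - v2 * w1" and "i = inverse D"
  ultimately have i: "(v1 * w2 - v2 * w1) * i = 1" by simp
  \<comment> \<open>The columns of \<open>?P\<close> are \<open>v\<close> and \<open>A v\<close>;
    \<open>?Q\<close> is its adjugate divided by the determinant \<open>D\<close>.\<close>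
  let ?P = "mat2 v1 w1 v2 w2" and ?Q = "mat2 (w2 * i) (- w1 * i) (- v2 * i) (v1 * i)"
  have PQ: "?P * ?Q = 1\<^sub>m 2"
    using i by (simp add: mat2_mult one_mat_2 mat2_eq_iff algebra_simps)
  have QP: "?Q * ?P = 1\<^sub>m 2"
    using i by (simp add: mat2_mult one_mat_2 mat2_eq_iff algebra_simps)
  have "mat2 a b c d * ?P = ?P * mat2 0 (b * c - a * d) 1 (a + d)"
    by (simp add: mat2_mult mat2_eq_iff w1_def w2_def algebra_simps)
  then have "?P * mat2 0 (b * c - a * d) 1 (a + d) * ?Q = mat2 a b c d * (?P * ?Q)"
    by (metis assoc_mult_mat mat2_carrier)
  also have "\<dots> = mat2 a b c d"
    unfolding PQ by simp
  finally show ?thesis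
    by (intro similar_matI[OF _ PQ QP]) auto
qed

text \<open>A characteristic polynomial that is not the square of a linear factor belongs to no
  scalar matrix, so all matrices having it share one companion form. This turns class membership
  into two polynomial equations.\<close>

lemma nonscalar_conj_class_eq:
  fixes X :: "'a :: field mat set"
  assumes X: "conj_class 2 X" and cp: "class_char_poly X = [:e, - t, 1:]"
    and nonscalar: "\<And>k. [:e, - t, 1:] \<noteq> [:- k, 1:] * [:- k, 1:]"
  shows "mat2 a b c d \<in> X \<longleftrightarrow> a + d = t \<and> a * d - b * c = e"
proof -
  have companion: "similar_mat (mat2 a b c d) (mat2 0 (- e) 1 t)"
    if "a + d = t" "a * d - b * c = e" for a b c d
  proof -
    have "\<not> (b = 0 \<and> c = 0 \<and> a = d)"
      using nonscalar[of a] that by auto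
    from nonscalar_similar_companion[OF this] that show ?thesis
      by (metis minus_diff_eq)
  qed
  have members: "a + d = t \<and> a * d - b * c = e" if "mat2 a b c d \<in> X" for a b c d
    using class_char_poly_eq[OF X that] unfolding cp char_poly_mat2 pCons_eq_iff neg_equal_iff_equal by simp
  obtain A where A: "A \<in> carrier_mat 2 2" "X = {B. similar_mat B A}"
    using X by (auto simp: conj_class_def)
  obtain a' b' c' d' where A': "A = mat2 a' b' c' d'"
    using A(1) by (rule mat2_cases)
  have "A \<in> X" using A by (simp add: similar_mat_refl)
  with members A' have "similar_mat A (mat2 0 (- e) 1 t)"
    using companion by blast
  then have "mat2 a b c d \<in> X" if "a + d = t" "a * d - b * c = e"
    using companion[OF that] A(2) similar_mat_sym similar_mat_trans by blast
  with members show ?thesis by blast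
qed

section \<open>The projective line\<close>

text \<open>The option type models the projective line: \<open>None\<close> is the line spanned by
  (0, 1), and \<open>Some m\<close> the line of slope \<open>m\<close>, spanned by (1, m).\<close>

fun hx :: "'a :: zero_neq_one option \<Rightarrow> 'a" where
  "hx None = 0" | "hx (Some m) = 1"

fun hy :: "'a :: zero_neq_one option \<Rightarrow> 'a" where
  "hy None = 1" | "hy (Some m) = m"

lemma hx_hy_nonzero: "hx L \<noteq> 0 \<or> hy L \<noteq> 0"
  by (cases L) auto

lemma hx_hy_inject:
  fixes L L' :: "'a :: field option"
  assumes "hx L * hy L' = hy L * hx L'"
  shows "L = L'"
  using assms by (cases L; cases L') auto

lemma singular_kernel:
  fixes a b c d :: "'a :: field"
  assumes "a * d - b * c = 0"
  obtains L where "a * hx L + b * hy L = 0" "c * hx L + d * hy L = 0"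
proof -
  consider "b = 0" "d = 0" | "b \<noteq> 0" | "b = 0" "d \<noteq> 0" by blast
  then show ?thesis
  proof cases
    case 1
    then show ?thesis by (intro that[of None]) auto
  next
    case 2
    then show ?thesis using assms by (intro that[of "Some (- a / b)"]) (auto simp: field_simps)
  next
    case 3
    then show ?thesis using assms by (intro that[of "Some (- c / d)"]) (auto simp: field_simps)
  qed
qed

text \<open>The two vectors \<open>v = (v1, v2)\<close> and \<open>A v\<close> have determinant \<open>cross a b c d v1 v2\<close>.\<close>

definition cross :: "'a :: field \<Rightarrow> 'a \<Rightarrow> 'a \<Rightarrow> 'a \<Rightarrow> 'a \<Rightarrow> 'a \<Rightarrow> 'a" where
  "cross a b c d v1 v2 = v1 * (c * v1 + d * v2) - v2 * (a * v1 + b * v2)"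

definition eigenlines :: "'a :: field \<Rightarrow> 'a \<Rightarrow> 'a \<Rightarrow> 'a \<Rightarrow> 'a option set" where
  "eigenlines a b c d = {L. cross a b c d (hx L) (hy L) = 0}"

lemma eigenlines_scalar: "eigenlines a 0 0 a = UNIV"
  by (auto simp: eigenlines_def cross_def)

text \<open>The slopes of eigenlines are the roots of a quadratic \<open>f\<close>. The vertical
  line is an eigenline only if \<open>b = 0\<close>, and then the degree of \<open>f\<close> drops,
  so the bound stays 2.\<close>

lemma card_eigenlines_le_2:
  fixes a b c d :: "'a :: field"
  assumes "\<not> (b = 0 \<and> c = 0 \<and> a = d)"
  shows "card (eigenlines a b c d) \<le> 2"
proof -
  define f where "f = [:c, d - a, - b:]"
  have "f \<noteq> 0" using assms by (auto simp: f_def)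
  then have fin: "finite {m. poly f m = 0}" and le: "card {m. poly f m = 0} \<le> degree f"
    by (simp_all add: poly_roots_finite card_poly_roots_bound)
  have E: "eigenlines a b c d = Some ` {m. poly f m = 0} \<union> (if b = 0 then {None} else {})"
  proof (rule Set.set_eqI)
    fix L show "L \<in> eigenlines a b c d \<longleftrightarrow>
        L \<in> Some ` {m. poly f m = 0} \<union> (if b = 0 then {None} else {})"
      by (cases L) (auto simp: eigenlines_def cross_def f_def algebra_simps)
  qed
  have "card (eigenlines a b c d) \<le> card {m. poly f m = 0} + (if b = 0 then 1 else 0)"
    unfolding E by (rule order.trans[OF card_Un_le]) (auto simp: card_image)
  also have "\<dots> \<le> 2"
    using le by (auto simp: f_def split: if_splits)
  finally show ?thesis .
qed

section \<open>Sums parametrised by lines\<close>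

text \<open>Used in contrapositive form: a matrix whose characteristic polynomial has no root has no
  eigenvector. In the main case the root is the eigenvalue of (1, m), where \<open>m\<close> is the
  slope.\<close>

lemma eigenvector_imp_root:
  fixes a b c d :: "'a :: field"
  assumes "v1 \<noteq> 0 \<or> v2 \<noteq> 0" and "cross a b c d v1 v2 = 0"
  shows "\<exists>k. k * k - (a + d) * k + (a * d - b * c) = 0"
proof (cases "v1 = 0")
  case True
  then have "b = 0" using assms by (auto simp: cross_def)
  then show ?thesis by (intro exI[of _ a]) (simp add: algebra_simps)
next
  case False
  define m where "m = v2 / v1"
  have v2: "v2 = m * v1" using False by (simp add: m_def)
  have "v1 * v1 * (c + d * m - m * (a + b * m)) = cross a b c d v1 v2"
    unfolding cross_def v2 by (simp add: algebra_simps)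
  then have "c + d * m - m * (a + b * m) = 0"
    using False assms(2) by simp
  then have c: "c = m * (a + b * m) - d * m"
    by (simp add: algebra_simps)
  show ?thesis
    by (rule exI[of _ "a + b * m"]) (simp add: c algebra_simps)
qed

text \<open>The tuples are the entries of \<open>x\<close>, and the last equation is the determinant
  of \<open>y = z - x\<close>, whose trace is right by \<open>tr\<close>. The bijection matches
  \<open>x\<close> with the \<open>lam\<close>-eigenline of \<open>y\<close>.\<close>

lemma card_sum_pairs:
  fixes p u r s t d lam mu :: "'a :: {field, finite}"
  assumes irr: "\<And>k. k * k - t * k + d \<noteq> 0" and ne: "lam \<noteq> mu" and tr: "p + s = t + (lam + mu)"
  shows "card {(a, b, c, e). a + e = t \<and> a * e - b * c = d \<and>
      (p - a) * (s - e) - (u - b) * (r - c) = lam * mu} = card (- eigenlines p u r s)"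
    (is "card ?S = _")
proof -
  \<comment> \<open>Here \<open>w = (z - lam) v\<close>, and \<open>D\<close> is the determinant of
    \<open>v\<close> and \<open>w\<close>. Subtracting \<open>lam v\<close> does not change it, so
    it vanishes exactly on eigenlines of \<open>z\<close>.\<close>
  define w1 w2 D where "w1 = (\<lambda>L. (p - lam) * hx L + u * hy L)"
    and "w2 = (\<lambda>L. r * hx L + (s - lam) * hy L)"
    and "D = (\<lambda>L. hx L * w2 L - hy L * w1 L)"
  note w = w1_def w2_def
  have D: "D L = cross p u r s (hx L) (hy L)" for L
    by (simp add: D_def w cross_def algebra_simps)
  \<comment> \<open>\<open>g\<close> sends a line to the matrix \<open>x\<close> with \<open>x v = w\<close> and \<open>x w = t w - d v\<close>.\<close>
  define g where "g = (\<lambda>L.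
    ((w1 L * w2 L - (t * w1 L - d * hx L) * hy L) / D L,
     ((t * w1 L - d * hx L) * hx L - w1 L * w1 L) / D L,
     (w2 L * w2 L - (t * w2 L - d * hy L) * hy L) / D L,
     ((t * w2 L - d * hy L) * hx L - w1 L * w2 L) / D L))"
  have g_props: "a * hx L + b * hy L = w1 L" "c * hx L + e * hy L = w2 L" "a + e = t" "a * e - b * c = d"
    if L: "D L \<noteq> 0" and g: "g L = (a, b, c, e)" for L a b c e
  proof -
    have a: "a * D L = w1 L * w2 L - (t * w1 L - d * hx L) * hy L"
      and b: "b * D L = (t * w1 L - d * hx L) * hx L - w1 L * w1 L"
      and c: "c * D L = w2 L * w2 L - (t * w2 L - d * hy L) * hy L"
      and e: "e * D L = (t * w2 L - d * hy L) * hx L - w1 L * w2 L"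
      using L g by (auto simp: g_def)
    have "(a * hx L + b * hy L) * D L = w1 L * D L"
      using a b unfolding D_def by Groebner_Basis.algebra
    then show 1: "a * hx L + b * hy L = w1 L" using L by simp
    have "(c * hx L + e * hy L) * D L = w2 L * D L"
      using c e unfolding D_def by Groebner_Basis.algebra
    then show 2: "c * hx L + e * hy L = w2 L" using L by simp
    have "(a + e) * D L = t * D L"
      using a e unfolding D_def by Groebner_Basis.algebra
    then show "a + e = t" using L by simp
    have "(a * e - b * c) * (D L * D L) = (a * D L) * (e * D L) - (b * D L) * (c * D L)"
      by (simp add: algebra_simps)
    also have "\<dots> = d * (D L * D L)"
      unfolding a b c e unfolding D_def by (simp add: algebra_simps)
    finally show "a * e - b * c = d" using L by simp
  qed
  have "bij_betw g (- eigenlines p u r s) ?S"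
    unfolding bij_betw_def
  proof (intro conjI inj_onI Set.set_eqI iffI)
    fix L L' assume "L \<in> - eigenlines p u r s" "L' \<in> - eigenlines p u r s" and gg: "g L = g L'"
    then have DL: "D L \<noteq> 0" "D L' \<noteq> 0" by (auto simp: eigenlines_def D)
    obtain a b c e where g: "g L = (a, b, c, e)" by (metis prod_cases4)
    note 1 = g_props[OF DL(1) g] and 2 = g_props[OF DL(2) g[unfolded gg]]
    show "L = L'"
    \<comment> \<open>If two distinct lines gave the same \<open>x\<close>, then \<open>y\<close>
      would act as \<open>lam\<close> on both, hence on the whole plane. Its trace would then force
      \<open>lam = mu\<close>.\<close>
    proof (rule ccontr)
      assume "L \<noteq> L'"
      then have \<delta>: "hx L * hy L' - hy L * hx L' \<noteq> 0" using hx_hy_inject by fastforce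
      have "(p - a - lam) * (hx L * hy L' - hy L * hx L') = 0"
        using 1(1) 2(1) unfolding w by Groebner_Basis.algebra
      moreover have "(s - e - lam) * (hx L * hy L' - hy L * hx L') = 0"
        using 1(2) 2(2) unfolding w by Groebner_Basis.algebra
      ultimately have "p - a - lam = 0" "s - e - lam = 0" using \<delta> by auto
      then have "lam = mu" using 1(3) tr by Groebner_Basis.algebra
      with ne show False by simp
    qed
  next
    fix x assume "x \<in> g ` (- eigenlines p u r s)"
    then obtain L where L: "x = g L" "D L \<noteq> 0" by (auto simp: eigenlines_def D)
    obtain a b c e where g: "g L = (a, b, c, e)" by (metis prod_cases4)
    note 1 = g_props[OF L(2) g]
    have k: "(p - a - lam) * hx L + (u - b) * hy L = 0" "(r - c) * hx L + (s - e - lam) * hy L = 0"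
      using 1(1,2) unfolding w by Groebner_Basis.algebra+
    \<comment> \<open>The nonzero vector \<open>v\<close> lies in the kernel of
      \<open>y - lam\<close>, so this determinant vanishes; together with the trace of
      \<open>y\<close> this gives its determinant.\<close>
    have "((p - a - lam) * (s - e - lam) - (u - b) * (r - c)) * hx L = 0"
      "((p - a - lam) * (s - e - lam) - (u - b) * (r - c)) * hy L = 0"
      using k by Groebner_Basis.algebra+
    then have "(p - a - lam) * (s - e - lam) - (u - b) * (r - c) = 0"
      using hx_hy_nonzero[of L] by auto
    then have "(p - a) * (s - e) - (u - b) * (r - c) = lam * mu"
      using 1(3) tr by Groebner_Basis.algebra
    then show "x \<in> ?S" using 1(3,4) L(1) g by simp
  next
    fix x assume "x \<in> ?S"
    then obtain a b c e where x: "x = (a, b, c, e)" and t: "a + e = t" and d: "a * e - b * c = d"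
      and y: "(p - a) * (s - e) - (u - b) * (r - c) = lam * mu" by auto
    \<comment> \<open>The characteristic polynomial of \<open>y\<close> vanishes at
      \<open>lam\<close>, which yields an eigenline.\<close>
    have "(p - a - lam) * (s - e - lam) - (u - b) * (r - c) = 0"
      using y t tr by Groebner_Basis.algebra
    then obtain L where "(p - a - lam) * hx L + (u - b) * hy L = 0"
      "(r - c) * hx L + (s - e - lam) * hy L = 0"
      by (rule singular_kernel)
    then have xv: "a * hx L + b * hy L = w1 L" "c * hx L + e * hy L = w2 L"
      unfolding w by Groebner_Basis.algebra+
    \<comment> \<open>Otherwise \<open>v\<close> would be parallel to \<open>w = x v\<close>, an
      eigenvector of \<open>x\<close>, against \<open>irr\<close>.\<close>
    have DL: "D L \<noteq> 0"
    proof
      assume "D L = 0"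
      then have "cross a b c e (hx L) (hy L) = 0"
        unfolding D_def cross_def using xv by simp
      from eigenvector_imp_root[OF hx_hy_nonzero this] irr t d show False by auto
    qed
    \<comment> \<open>Cramer's rule for \<open>x v = w\<close> and
      \<open>x w = t w - d v\<close>.\<close>
    have "a * D L = w1 L * w2 L - (t * w1 L - d * hx L) * hy L"
      "b * D L = (t * w1 L - d * hx L) * hx L - w1 L * w1 L"
      "c * D L = w2 L * w2 L - (t * w2 L - d * hy L) * hy L"
      "e * D L = (t * w2 L - d * hy L) * hx L - w1 L * w2 L"
      unfolding D_def xv[symmetric] t[symmetric] d[symmetric] by (simp_all add: algebra_simps)
    then have "g L = x" using DL by (auto simp: g_def x field_simps)
    then show "x \<in> g ` (- eigenlines p u r s)" using DL by (auto simp: eigenlines_def D)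
  qed
  from bij_betw_same_card[OF this] show ?thesis by simp
qed

section \<open>Reduction of the count over conjugacy classes to the count of lines\<close>

theorem theorem1p1:
  fixes X Y :: "'a :: {field, finite} mat set" and z :: "'a mat" and lam mu :: 'a and q :: nat
  assumes "q = card (UNIV :: 'a set)"
    and "conj_class 2 X" and "irreducible (class_char_poly X)" and "degree (class_char_poly X) = 2"
    and "conj_class 2 Y" and "class_char_poly Y = [:- lam, 1:] * [:- mu, 1:]" and "lam \<noteq> mu"
    and "z \<in> carrier_mat 2 2" and "mat_trace z = class_trace X + class_trace Y"
  shows "(scalar_mat z \<longrightarrow> sum_count X Y z = 0) \<and>
         (\<not> scalar_mat z \<longrightarrow> sum_count X Y z \<in> {q - 1, q, q + 1})"
proof -
  obtain p u r s where z: "z = mat2 p u r s"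
    using assms(8) by (rule mat2_cases)
  have XC: "X \<subseteq> carrier_mat 2 2" and YC: "Y \<subseteq> carrier_mat 2 2"
    using assms(2,5) by (auto dest: conj_class_subset_carrier)
  obtain x where "x \<in> X" using some_in_conj_class[OF assms(2)] by blast
  moreover from this XC obtain xa xb xc xd where "x = mat2 xa xb xc xd"
    using mat2_cases by blast
  moreover define t d where "t = xa + xd" and "d = xa * xd - xb * xc"
  ultimately have cpX: "class_char_poly X = [:d, - t, 1:]" and trX: "class_trace X = t"
    using class_char_poly_eq[OF assms(2)] class_trace_eq[OF assms(2)]
    by (simp_all add: char_poly_mat2 mat_trace_mat2)
  obtain y where "y \<in> Y" using some_in_conj_class[OF assms(5)] by blast
  moreover from this YC obtain ya yb yc yd where "y = mat2 ya yb yc yd"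
    using mat2_cases by blast
  moreover have cpY: "class_char_poly Y = [:lam * mu, - (lam + mu), 1:]"
    using assms(6) by (simp add: algebra_simps)
  ultimately have trY: "class_trace Y = lam + mu"
    using class_char_poly_eq[OF assms(5), of y] class_trace_eq[OF assms(5), of y]
    by (simp add: char_poly_mat2 mat_trace_mat2 del: minus_add_distrib)
  \<comment> \<open>A root would split the quadratic into two linear factors, neither of which is a
    unit.\<close>
  have irr: "k * k - t * k + d \<noteq> 0" for k
  proof
    assume "k * k - t * k + d = 0"
    then have "poly (class_char_poly X) k = 0" by (simp add: cpX algebra_simps)
    then obtain f where f: "class_char_poly X = [:- k, 1:] * f"
      by (auto simp: poly_eq_0_iff_dvd)
    then have "f \<noteq> 0" using assms(3) by auto
    then have "degree f = 1" using f assms(4) by (simp add: degree_mult_eq del: mult_pCons_left)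
    then show False
      using irreducibleD[OF assms(3) f] by (auto simp: is_unit_iff_degree \<open>f \<noteq> 0\<close>)
  qed
  have X: "mat2 a b c e \<in> X \<longleftrightarrow> a + e = t \<and> a * e - b * c = d" for a b c e
  proof (rule nonscalar_conj_class_eq[OF assms(2) cpX])
    fix k show "[:d, - t, 1:] \<noteq> [:- k, 1:] * [:- k, 1:]"
    proof
      assume "[:d, - t, 1:] = [:- k, 1:] * [:- k, 1:]"
      then have "poly [:d, - t, 1:] k = 0" by simp
      then show False using irr[of k] by (simp add: algebra_simps)
    qed
  qed
  have Y: "mat2 a b c e \<in> Y \<longleftrightarrow> a + e = lam + mu \<and> a * e - b * c = lam * mu" for a b c e
  proof (rule nonscalar_conj_class_eq[OF assms(5) cpY])
    fix k show "[:lam * mu, - (lam + mu), 1:] \<noteq> [:- k, 1:] * [:- k, 1:]"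
    proof
      assume *: "[:lam * mu, - (lam + mu), 1:] = [:- k, 1:] * [:- k, 1:]"
      \<comment> \<open>Evaluating the supposed square at \<open>lam\<close> and at
        \<open>mu\<close> makes both equal to \<open>k\<close>.\<close>
      have "(lam - k) * (lam - k) = poly ([:- k, 1:] * [:- k, 1:]) lam"
        "(mu - k) * (mu - k) = poly ([:- k, 1:] * [:- k, 1:]) mu" by (simp_all add: algebra_simps)
      then have "(lam - k) * (lam - k) = 0" "(mu - k) * (mu - k) = 0"
        unfolding *[symmetric] by (simp_all add: algebra_simps)
      then show False using assms(7) by simp
    qed
  qed
  have tr: "p + s = t + (lam + mu)"
    using assms(9) by (simp add: z trX trY mat_trace_mat2)
  let ?S = "{(a, b, c, e). a + e = t \<and> a * e - b * c = d \<and>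
      (p - a) * (s - e) - (u - b) * (r - c) = lam * mu}"
  let ?h = "\<lambda>(a, b, c, e). (mat2 a b c e, mat2 (p - a) (u - b) (r - c) (s - e))"
  have "{(x, y). x \<in> X \<and> y \<in> Y \<and> x + y = z} = ?h ` ?S" (is "?T = _")
  proof (intro equalityI subsetI)
    fix v assume "v \<in> ?T"
    then obtain x y where v: "v = (x, y)" "x \<in> X" "y \<in> Y" "x + y = z" by auto
    obtain a b c e where x: "x = mat2 a b c e" using v XC mat2_cases by blast
    obtain a' b' c' e' where y: "y = mat2 a' b' c' e'" using v YC mat2_cases by blast
    have y': "a' = p - a" "b' = u - b" "c' = r - c" "e' = s - e"
      using v(4) by (auto simp: x y z mat2_add mat2_eq_iff)
    then have "(a, b, c, e) \<in> ?S" using v(2,3) X Y x y by auto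
    then show "v \<in> ?h ` ?S" by (rule rev_image_eqI) (simp add: v(1) x y y')
  next
    fix v assume "v \<in> ?h ` ?S"
    then obtain a b c e where v: "v = ?h (a, b, c, e)" and S: "(a, b, c, e) \<in> ?S" by blast
    have "p - a + (s - e) = lam + mu" using S tr by (auto simp: algebra_simps)
    then show "v \<in> ?T"
      using S by (simp add: v X Y z mat2_add)
  qed
  moreover have "inj_on ?h ?S"
    by (auto simp: inj_on_def mat2_eq_iff)
  ultimately have "sum_count X Y z = card ?S"
    unfolding sum_count_def by (simp only: card_image)
  also have "\<dots> = card (- eigenlines p u r s)"
    by (rule card_sum_pairs[OF irr assms(7) tr])
  \<comment> \<open>The projective line has \<open>q + 1\<close> points.\<close>
  also have "\<dots> = q + 1 - card (eigenlines p u r s)"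
    by (simp add: Compl_eq_Diff_UNIV card_Diff_subset card_UNIV_option assms(1))
  finally have count: "sum_count X Y z = q + 1 - card (eigenlines p u r s)" .
  show ?thesis
  proof (intro conjI impI)
    assume "scalar_mat z"
    then have "eigenlines p u r s = UNIV"
      by (auto simp: z scalar_mat_mat2 eigenlines_scalar)
    then show "sum_count X Y z = 0" by (simp add: count card_UNIV_option assms(1))
  next
    assume "\<not> scalar_mat z"
    then have "card (eigenlines p u r s) \<le> 2"
      by (intro card_eigenlines_le_2) (simp add: z scalar_mat_mat2)
    then show "sum_count X Y z \<in> {q - 1, q, q + 1}"
      unfolding count by auto
  qed
qed

end
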